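(* Let $X$, $Y$, $Z$ and $B$ be $k$-spaces, with $B$ weak Hausdorff, and let $p:X\to B$, $q:Y\to B$ and $r:Z\to B$ be continuous maps. Then the rule $f^{>}(x,y)=f^{<}(x)(y)$, for $(x,y)$ with $p(x)=q(y)$, determines a bijective correspondence between (a) continuous maps $f^{>}:X\sqcap Y\to Z$, and (b) fibrewise maps $f^{<}:X\to Y!Z$, i.e. continuous maps $f^{<}$ with $(q!Z)\circ f^{<}=p$.
   Context: For a topological space $X$, $kX$ is the set $X$ with the final topology relative to all continuous maps $C\to X$ from compact Hausdorff spaces $C$; $X$ is a $k$-space if $kX=X$. All spaces are $k$-spaces and all constructions are $k$-ified: $X\times Y$ means $k$ of the usual product; for maps $p:X\to B$, $q:Y\to B$, the pullback $X\sqcap Y=\{(x,y): p(x)=q(y)\}$ has the $k$-ification of the subspace topology from the usual product; $M(Y,Z)$ is the set of continuous maps $Y\to Z$ with the $k$-ification of the compact-open topology. $B$ is weak Hausdorff if the diagonal $\{(b,b)\}$ is closed in the ($k$-ified) product $B\times B$ (this implies $B$ is $T_1$). Free range mapping space: let $q:Y\to B$ be a map, $B$ a $T_1$ space, and $Y|b=q^{-1}(b)$. As a set, $Y!Z=\bigcup_{b\in B}M(Y|b,Z)$ (disjoint union), and $q!Z:Y!Z\to B$ sends every map $Y|b\to Z$ to $b$. Let $Z^{\sim}=Z\cup\{\omega\}$ with $\omega\notin Z$, whose closed sets are $Z^{\sim}$ itself and the closed sets of $Z$. For $f:Y|b\to Z$ let $i(f):Y\to Z^{\sim}$ equal $f$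 on $Y|b$ and $\omega$ elsewhere. $Y!Z$ carries the $k$-ification of the initial topology relative to $i:Y!Z\to M(Y,Z^{\sim})$ and $q!Z$. *)

theory Defs
  imports "HOL-Analysis.Analysis"
begin

section \<open>The k-ification of a topology\<close>

text \<open>
  The k-ification of \<open>X\<close> carries the final topology for all continuous maps \<open>C \<rightarrow> X\<close> out of compact
  Hausdorff spaces \<open>C\<close>. A definition cannot range over all types, so the test spaces \<open>C\<close> live on the
  one type \<open>('a + nat) set set\<close>. This loses nothing: \<open>openin_kify_preimage\<close> below shows that a set
  that is open for these tests is open for the tests on every type.

  The library predicate \<open>k_space\<close> tests against compact subspaces that need not be Hausdorff
  and is a different notion.
\<close>

definition kify :: "'a topology \<Rightarrow> 'a topology" where
  "kify X = topology (\<lambda>U. U \<subseteq> topspace X \<and>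
     (\<forall>(C :: ('a + nat) set set topology) t.
        compact_space C \<and> Hausdorff_space C \<and> continuous_map C X t \<longrightarrow>
        openin C {c \<in> topspace C. t c \<in> U}))"

definition is_k_space :: "'a topology \<Rightarrow> bool" where
  "is_k_space X \<longleftrightarrow> kify X = X"

lemma openin_kify:
  fixes X :: "'a topology"
  shows "openin (kify X) U \<longleftrightarrow> U \<subseteq> topspace X \<and>
     (\<forall>(C :: ('a + nat) set set topology) t.
        compact_space C \<and> Hausdorff_space C \<and> continuous_map C X t \<longrightarrow>
        openin C {c \<in> topspace C. t c \<in> U})"
proof -
  have "istopology (\<lambda>U. U \<subseteq> topspace X \<and>
     (\<forall>(C :: ('a + nat) set set topology) t.
        compact_space C \<and> Hausdorff_space C \<and> continuous_map C X t \<longrightarrow>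
        openin C {c \<in> topspace C. t c \<in> U}))" (is "istopology ?P")
    unfolding istopology_def
  proof (intro conjI allI impI)
    fix S T assume "?P S" "?P T"
    then show "S \<inter> T \<subseteq> topspace X" by blast
    fix C :: "('a + nat) set set topology" and t
    assume C: "compact_space C \<and> Hausdorff_space C \<and> continuous_map C X t"
    have "{c \<in> topspace C. t c \<in> S \<inter> T} = {c \<in> topspace C. t c \<in> S} \<inter> {c \<in> topspace C. t c \<in> T}"
      by blast
    with \<open>?P S\<close> \<open>?P T\<close> C show "openin C {c \<in> topspace C. t c \<in> S \<inter> T}" by auto
  next
    fix \<K> assume K: "\<forall>K\<in>\<K>. ?P K"
    then show "\<Union>\<K> \<subseteq> topspace X" by blast
    fix C :: "('a + nat) set set topology" and t
    assume C: "compact_space C \<and> Hausdorff_space C \<and> continuous_map C X t"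
    have "{c \<in> topspace C. t c \<in> \<Union>\<K>} = (\<Union>K\<in>\<K>. {c \<in> topspace C. t c \<in> K})"
      by blast
    with K C show "openin C {c \<in> topspace C. t c \<in> \<Union>\<K>}" by auto
  qed
  then show ?thesis
    unfolding kify_def by (simp add: topology_inverse')
qed

lemma topspace_kify [simp]: "topspace (kify X) = topspace X"
proof
  show "topspace (kify X) \<subseteq> topspace X"
    using openin_kify[of X "topspace (kify X)"] by auto
  have "openin (kify X) (topspace X)"
    unfolding openin_kify by (auto intro: openin_continuous_map_preimage)
  then show "topspace X \<subseteq> topspace (kify X)"
    by (rule openin_subset)
qed

lemma card_Times_le:
  includes cardinal_syntax
  assumes "infinite P" "|A| \<le>o |P|" "|B| \<le>o |P|"
  shows "|A \<times> B| \<le>o |P|"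
  using assms card_of_Times_ordLeq_infinite_Field[of "|P|" A B] card_of_Card_order[of P]
  by (simp add: Field_card_of)

lemma card_Un_le:
  includes cardinal_syntax
  assumes "infinite P" "|A| \<le>o |P|" "|B| \<le>o |P|"
  shows "|A \<union> B| \<le>o |P|"
  using assms card_of_Un_ordLeq_infinite_Field[of "|P|" A B] card_of_Card_order[of P]
  by (simp add: Field_card_of)

lemma closure_under_operations:
  includes cardinal_syntax
  fixes Ops :: "('d \<Rightarrow> 'd \<Rightarrow> 'd) set" and s :: 'd
  assumes inf: "infinite (UNIV :: 'p set)" and Ops: "|Ops| \<le>o |UNIV :: 'p set|"
  shows "\<exists>J. s \<in> J \<and> (\<forall>f\<in>Ops. \<forall>a\<in>J. \<forall>b\<in>J. f a b \<in> J) \<and> |J| \<le>o |UNIV :: 'p set|"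
proof -
  define step where "step S = S \<union> (\<lambda>(f, a, b). f a b) ` (Ops \<times> S \<times> S)" for S
  define Jn where "Jn n = (step ^^ n) {s}" for n
  have Jn_Suc: "Jn (Suc n) = step (Jn n)" for n by (simp add: Jn_def)
  have card: "|Jn n| \<le>o |UNIV :: 'p set|" for n
  proof (induction n)
    case 0
    show ?case using inf by (auto simp: Jn_def intro: card_of_singl_ordLeq)
  next
    case (Suc n)
    have "|Ops \<times> Jn n \<times> Jn n| \<le>o |UNIV :: 'p set|"
      using Suc Ops inf by (intro card_Times_le) auto
    then have "|(\<lambda>(f, a, b). f a b) ` (Ops \<times> Jn n \<times> Jn n)| \<le>o |UNIV :: 'p set|"
      using card_of_image ordLeq_transitive by blast
    then show ?case
      unfolding Jn_Suc step_def using Suc inf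
      by (intro card_Un_le) auto
  qed
  have mono: "Jn m \<subseteq> Jn n" if "m \<le> n" for m n
    using that by (rule lift_Suc_mono_le[rotated]) (auto simp: Jn_Suc step_def)
  show ?thesis
  proof (intro exI[of _ "\<Union>n. Jn n"] conjI ballI)
    show "s \<in> (\<Union>n. Jn n)" using Jn_def[of 0] by auto
  next
    fix f a b assume f: "f \<in> Ops" and "a \<in> (\<Union>n. Jn n)" "b \<in> (\<Union>n. Jn n)"
    then obtain m n where "a \<in> Jn m" "b \<in> Jn n" by blast
    then have "a \<in> Jn (max m n)" "b \<in> Jn (max m n)"
      using mono[of m "max m n"] mono[of n "max m n"] by auto
    with f have "f a b \<in> Jn (Suc (max m n))"
      unfolding Jn_Suc step_def by force
    then show "f a b \<in> (\<Union>n. Jn n)" by blast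
  next
    have "|UNIV :: nat set| \<le>o |UNIV :: 'p set|" using inf infinite_iff_card_of_nat by blast
    then show "|\<Union>n. Jn n| \<le>o |UNIV :: 'p set|"
      using card inf by (intro card_of_UNION_ordLeq_infinite) auto
  qed
qed

lemma compact_Hausdorff_bump:
  assumes "compact_space C" "Hausdorff_space C" "openin C W" "y \<in> W"
  shows "\<exists>g. continuous_map C euclideanreal g \<and> g y > 0 \<and> (\<forall>x\<in>topspace C. g x > 0 \<longrightarrow> x \<in> W)"
proof -
  have "completely_regular_space C"
    using assms compact_Hausdorff_or_regular_imp_normal_space normal_imp_completely_regular_space
    by blast
  then obtain f where f: "continuous_map C euclideanreal f" "f y = 0" "f ` (topspace C - W) \<subseteq> {1}"
    using assms unfolding completely_regular_space_alt' by blast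
  show ?thesis
  proof (intro exI conjI ballI impI)
    show "continuous_map C euclideanreal (\<lambda>x. 1 - f x)"
      using f by (intro continuous_intros) auto
  qed (use f in auto)
qed

text \<open>
  A Loewenheim-Skolem argument: given \<open>t : C \<rightarrow> X\<close>, close off a set \<open>J\<close> of at most \<open>|('a + nat) set|\<close>
  continuous real functions on \<open>C\<close> and replace \<open>C\<close> by its quotient under the equivalence of
  not being separated by \<open>J\<close>.
\<close>

lemma openin_kify_preimage:
  includes cardinal_syntax
  fixes X :: "'a topology" and C :: "'c topology"
  assumes U: "openin (kify X) U"
    and C: "compact_space C" "Hausdorff_space C" and t: "continuous_map C X t"
  shows "openin C {c \<in> topspace C. t c \<in> U}"
proof (rule ccontr)
  assume notopen: "\<not> ?thesis"
  obtain c where c: "c \<in> topspace C" "t c \<in> U"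
    and near: "\<And>N. openin C N \<Longrightarrow> c \<in> N \<Longrightarrow> \<exists>a\<in>N. t a \<notin> U"
  proof -
    from notopen obtain c where c: "c \<in> topspace C" "t c \<in> U"
      and no: "\<And>T. openin C T \<Longrightarrow> c \<in> T \<Longrightarrow> \<not> T \<subseteq> {c \<in> topspace C. t c \<in> U}"
      using openin_subopen[of C "{c \<in> topspace C. t c \<in> U}"] by blast
    have "\<exists>a\<in>N. t a \<notin> U" if "openin C N" "c \<in> N" for N
      using no[OF that] openin_subset[OF that(1)] by blast
    with c show thesis by (rule that)
  qed
  define ct where "ct g \<longleftrightarrow> continuous_map C euclideanreal g" for g :: "'c \<Rightarrow> real"
  have open_gt: "openin C {x \<in> topspace C. g x > 0}" and open_lt: "openin C {x \<in> topspace C. g x < 0}"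
    if "ct g" for g
    using openin_continuous_map_preimage[of C euclideanreal g "{0<..}"]
      openin_continuous_map_preimage[of C euclideanreal g "{..<0}"] that
    by (auto simp: ct_def)
  have closed_le: "closedin C {x \<in> topspace C. g x \<le> 0}" if "ct g" for g
    using closedin_continuous_map_preimage[of C euclideanreal g "{..0}"] that by (auto simp: ct_def)
  have ct0: "ct (\<lambda>_. 0)" by (simp add: ct_def)

  have "\<exists>g. ct g \<and> (openin C W \<and> y \<in> W \<longrightarrow> g y > 0 \<and> (\<forall>x\<in>topspace C. g x > 0 \<longrightarrow> x \<in> W))" for W y
    using compact_Hausdorff_bump[OF C, of W y] ct0 unfolding ct_def by blast
  then obtain phi where phi_ct: "\<And>W y. ct (phi W y)"
    and phi_pos: "\<And>W y. openin C W \<Longrightarrow> y \<in> W \<Longrightarrow> phi W y y > 0"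
    and phi_sub: "\<And>W y x. openin C W \<Longrightarrow> y \<in> W \<Longrightarrow> x \<in> topspace C \<Longrightarrow> phi W y x > 0 \<Longrightarrow> x \<in> W"
    by metis

  define pre where "pre V = {x \<in> topspace C. t x \<in> V}" for V
  have pre_open: "openin C (pre V)" if "openin X V" for V
    unfolding pre_def using openin_continuous_map_preimage[OF t that] .

  have "\<exists>a. ct k \<and> k c < 0 \<longrightarrow> a \<in> topspace C \<and> k a < 0 \<and> t a \<notin> U" for k
    using near[OF open_lt[of k]] c by blast
  then obtain a where a: "\<And>k. ct k \<Longrightarrow> k c < 0 \<Longrightarrow> a k \<in> topspace C \<and> k (a k) < 0 \<and> t (a k) \<notin> U"
    by metis

  define covers where "covers R k w \<longleftrightarrow> (\<forall>n. ct (w n)) \<and>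
      (ct k \<and> (\<forall>x. openin X (R `` {x})) \<and> (\<forall>y\<in>topspace C. k y \<le> 0 \<longrightarrow> (\<exists>x. t y \<in> R `` {x})) \<longrightarrow>
        (\<forall>y\<in>topspace C. k y \<le> 0 \<longrightarrow> (\<exists>n. w n y > 0)) \<and>
        (\<forall>n. \<exists>x. \<forall>y\<in>topspace C. w n y > 0 \<longrightarrow> t y \<in> R `` {x}))"
    for R :: "('a \<times> 'a) set" and k and w :: "nat \<Rightarrow> 'c \<Rightarrow> real"
  have ex_covers: "\<exists>w. covers R k w" for R k
  proof (cases "ct k \<and> (\<forall>x. openin X (R `` {x})) \<and> (\<forall>y\<in>topspace C. k y \<le> 0 \<longrightarrow> (\<exists>x. t y \<in> R `` {x}))")
    case False
    then have "covers R k (\<lambda>_ _. 0)" using ct0 unfolding covers_def by blast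
    then show ?thesis by (rule exI[where P = "covers R k"])
  next
    case True
    let ?K = "{x \<in> topspace C. k x \<le> 0}"
    have "\<forall>y\<in>?K. \<exists>x. t y \<in> R `` {x}" using True by blast
    then obtain xx where xx: "\<And>y. y \<in> ?K \<Longrightarrow> t y \<in> R `` {xx y}" by metis
    define g where "g y = phi (pre (R `` {xx y})) y" for y
    have inpre: "y \<in> pre (R `` {xx y})" if "y \<in> ?K" for y
      using xx[OF that] that by (auto simp: pre_def)
    have opre: "openin C (pre (R `` {x}))" for x using True pre_open by blast
    have g_pos: "g y y > 0" if "y \<in> ?K" for y
      using phi_pos[OF opre inpre[OF that]] by (simp add: g_def)
    have g_sub: "t x \<in> R `` {xx y}" if "y \<in> ?K" "x \<in> topspace C" "g y x > 0" for x y
      using phi_sub[OF opre inpre[OF that(1)] that(2)] that(3) unfolding g_def pre_def by blast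
    let ?N = "\<lambda>y. {x \<in> topspace C. g y x > 0}"
    have "compactin C ?K" using closed_le True C closedin_compact_space by blast
    moreover have "\<forall>N\<in>?N ` ?K. openin C N" using open_gt phi_ct by (auto simp: g_def)
    moreover have "?K \<subseteq> \<Union>(?N ` ?K)" using g_pos by blast
    ultimately obtain \<F> where \<F>: "finite \<F>" "\<F> \<subseteq> ?N ` ?K" "?K \<subseteq> \<Union>\<F>"
      unfolding compactin_def by meson
    obtain Y where Y: "finite Y" "Y \<subseteq> ?K" "\<F> = ?N ` Y"
      using finite_subset_image[OF \<F>(1,2)] by blast
    define G where "G = insert (\<lambda>_. 0) (g ` Y)"
    have G: "countable G" "G \<noteq> {}" using Y(1) by (auto simp: G_def intro: countable_finite)
    have rG: "range (from_nat_into G) = G" using G by (simp add: range_from_nat_into)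
    have G_ct: "ct f" if "f \<in> G" for f using that ct0 phi_ct by (auto simp: G_def g_def)
    have G_sub: "\<exists>x. \<forall>y\<in>topspace C. f y > 0 \<longrightarrow> t y \<in> R `` {x}" if f: "f \<in> G" for f
    proof (cases "f = (\<lambda>_. 0)")
      case False
      then obtain y where "y \<in> Y" "f = g y" using f by (auto simp: G_def)
      then show ?thesis using g_sub Y(2) by blast
    qed auto
    have G_cov: "\<exists>f\<in>G. f y > 0" if "y \<in> ?K" for y
      using that \<F>(3) Y(3) by (auto simp: G_def)
    have "covers R k (from_nat_into G)"
      unfolding covers_def
    proof (intro conjI impI allI ballI)
      fix n
      have "from_nat_into G n \<in> G" using G from_nat_into by blast
      then show "ct (from_nat_into G n)"
        "\<exists>x. \<forall>y\<in>topspace C. from_nat_into G n y > 0 \<longrightarrow> t y \<in> R `` {x}"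
        using G_ct G_sub by blast+
    next
      fix y assume "y \<in> topspace C" "k y \<le> 0"
      then obtain f where "f \<in> G" "f y > 0" using G_cov by blast
      then show "\<exists>n. from_nat_into G n y > 0" using rG by (metis imageE)
    qed
    then show ?thesis by (rule exI[where P = "covers R k"])
  qed
  define w where "w R k = (SOME w. covers R k w)" for R k
  have w: "covers R k (w R k)" for R k
    unfolding w_def using ex_covers by (rule someI_ex)
  have w_ct: "ct (w R k n)" for R k n
    using w[of R k] unfolding covers_def by blast
  have w_cov: "\<exists>n. w R k n y > 0" if "ct k" "\<forall>x. openin X (R `` {x})"
      "\<forall>y\<in>topspace C. k y \<le> 0 \<longrightarrow> (\<exists>x. t y \<in> R `` {x})" "y \<in> topspace C" "k y \<le> 0" for R k y
    using w[of R k] that unfolding covers_def by blast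
  have w_sub: "\<exists>x. \<forall>y\<in>topspace C. w R k n y > 0 \<longrightarrow> t y \<in> R `` {x}"
    if "ct k" "\<forall>x. openin X (R `` {x})" "\<forall>y\<in>topspace C. k y \<le> 0 \<longrightarrow> (\<exists>x. t y \<in> R `` {x})" for R k n
    using w[of R k] that unfolding covers_def by blast

  define O1 where "O1 = (\<lambda>(k :: 'c \<Rightarrow> real) (l :: 'c \<Rightarrow> real) x. - k x)"
  define O2 where "O2 q = (\<lambda>(k :: 'c \<Rightarrow> real) (l :: 'c \<Rightarrow> real) x. k x - of_rat q)" for q
  define O3 where "O3 = (\<lambda>(k :: 'c \<Rightarrow> real) (l :: 'c \<Rightarrow> real) x. max (k x) (l x))"
  define O4 where "O4 V = (\<lambda>(k :: 'c \<Rightarrow> real) (l :: 'c \<Rightarrow> real). phi (pre V) c)" for V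
  define O5 where "O5 V = (\<lambda>(k :: 'c \<Rightarrow> real) (l :: 'c \<Rightarrow> real). phi (pre V) (a k))" for V
  define O6 where "O6 = (\<lambda>(k :: 'c \<Rightarrow> real) (l :: 'c \<Rightarrow> real). phi (topspace C - {a k}) c)"
  define O7 where "O7 Rn = (\<lambda>(k :: 'c \<Rightarrow> real) (l :: 'c \<Rightarrow> real). w (fst Rn) k (snd Rn))"
    for Rn :: "('a \<times> 'a) set \<times> nat"
  define Ops where "Ops = {O1, O3, O6} \<union> range O2 \<union> range O4 \<union> range O5 \<union> range O7"
  let ?Q = "UNIV :: ('a + nat) set set"
  have infB: "infinite (UNIV :: ('a + nat) set)"
    using finite_Plus_UNIV_iff infinite_UNIV_nat by blast
  have infQ: "infinite ?Q" using infB by (simp add: Finite_Set.finite_set)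
  have natQ: "|UNIV :: nat set| \<le>o |?Q|" using infQ infinite_iff_card_of_nat by blast
  have ctbl: "|S| \<le>o |?Q|" if "countable S" for S :: "'e set"
    using that natQ unfolding countable_def by (meson card_of_ordLeqI UNIV_I ordLeq_transitive)
  have aQ: "|UNIV :: 'a set set| \<le>o |?Q|"
    by (rule card_of_ordLeqI[of "image Inl"]) (auto simp: inj_on_def inj_image_eq_iff)
  have "|UNIV :: ('a \<times> 'a) set| \<le>o |UNIV :: ('a + nat) set|"
  proof -
    have "|UNIV :: 'a set| \<le>o |UNIV :: ('a + nat) set|"
      by (rule card_of_ordLeqI[of Inl]) auto
    then have "|(UNIV :: 'a set) \<times> (UNIV :: 'a set)| \<le>o |UNIV :: ('a + nat) set|"
      using infB by (intro card_Times_le) auto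
    then show ?thesis by simp
  qed
  then obtain ee :: "'a \<times> 'a \<Rightarrow> 'a + nat" where "inj ee"
    unfolding card_of_ordLeq[symmetric] by blast
  then have RQ: "|UNIV :: ('a \<times> 'a) set set| \<le>o |?Q|"
    by (intro card_of_ordLeqI[of "image ee"]) (auto simp: inj_on_def inj_image_eq_iff)
  then have "|(UNIV :: ('a \<times> 'a) set set) \<times> (UNIV :: nat set)| \<le>o |?Q|"
    using infQ natQ by (intro card_Times_le) auto
  then have RnQ: "|UNIV :: (('a \<times> 'a) set \<times> nat) set| \<le>o |?Q|" by simp
  have rng: "|range f| \<le>o |?Q|" if "|UNIV :: 'e set| \<le>o |?Q|"
    for f :: "'e \<Rightarrow> ('c \<Rightarrow> real) \<Rightarrow> ('c \<Rightarrow> real) \<Rightarrow> 'c \<Rightarrow> real"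
    using that card_of_image ordLeq_transitive by blast
  have un: "|A \<union> B| \<le>o |?Q|" if "|A| \<le>o |?Q|" "|B| \<le>o |?Q|"
    for A B :: "(('c \<Rightarrow> real) \<Rightarrow> ('c \<Rightarrow> real) \<Rightarrow> 'c \<Rightarrow> real) set"
    using that infQ by (intro card_Un_le) auto
  have "|range O2| \<le>o |?Q|" "|{O1, O3, O6}| \<le>o |?Q|"
    by (auto intro!: ctbl)
  then have OpsQ: "|Ops| \<le>o |?Q|"
    unfolding Ops_def using rng[of O4] rng[of O5] rng[of O7] aQ RnQ by (intro un) auto
  obtain J0 where J0: "(\<lambda>_. 0) \<in> J0" "\<forall>f\<in>Ops. \<forall>k\<in>J0. \<forall>l\<in>J0. f k l \<in> J0" "|J0| \<le>o |?Q|"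
    using closure_under_operations[OF infQ OpsQ, of "\<lambda>_. 0"] by (elim exE conjE)
  define J where "J = {k \<in> J0. ct k}"
  have J_ct: "ct k" if "k \<in> J" for k using that by (simp add: J_def)
  have J_zero: "(\<lambda>_. 0) \<in> J" using J0(1) ct0 by (simp add: J_def)
  have Ops_ct: "ct (f k l)" if "f \<in> Ops" "ct k" "ct l" for f k l
    using that phi_ct w_ct unfolding Ops_def O1_def O2_def O3_def O4_def O5_def O6_def O7_def ct_def
    by (auto intro!: continuous_intros)
  have J_ops: "f k l \<in> J" if "f \<in> Ops" "k \<in> J" "l \<in> J" for f k l
    using that J0(2) Ops_ct by (auto simp: J_def)
  have J_neg: "(\<lambda>x. - k x) \<in> J" if "k \<in> J" for k
    using J_ops[of O1 k k] that by (simp add: Ops_def O1_def)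
  have J_diff: "(\<lambda>x. k x - of_rat q) \<in> J" if "k \<in> J" for k q
    using J_ops[of "O2 q" k k] that by (simp add: Ops_def O2_def)
  have J_max: "(\<lambda>x. max (k x) (l x)) \<in> J" if "k \<in> J" "l \<in> J" for k l
    using J_ops[of O3 k l] that by (simp add: Ops_def O3_def)
  have J_c: "phi (pre V) c \<in> J" for V
    using J_ops[of "O4 V", OF _ J_zero J_zero] by (simp add: Ops_def O4_def)
  have J_a: "phi (pre V) (a k) \<in> J" if "k \<in> J" for V k
    using J_ops[of "O5 V" k k] that by (simp add: Ops_def O5_def)
  have J_sep: "phi (topspace C - {a k}) c \<in> J" if "k \<in> J" for k
    using J_ops[of O6 k k] that by (simp add: Ops_def O6_def)
  have J_w: "w R k n \<in> J" if "k \<in> J" for R k n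
  proof -
    have "O7 (R, n) \<in> Ops" by (simp add: Ops_def)
    from J_ops[OF this that that] show ?thesis by (simp add: O7_def)
  qed

  have "|J| \<le>o |?Q|"
    using J0(3) card_of_mono1[of J J0] ordLeq_transitive unfolding J_def by blast
  then obtain enc :: "('c \<Rightarrow> real) \<Rightarrow> ('a + nat) set" where enc: "inj_on enc J"
    unfolding card_of_ordLeq[symmetric] by blast
  define h where "h x = enc ` {j \<in> J. j x > 0}" for x
  have h_iff: "h x = h y \<longleftrightarrow> (\<forall>j\<in>J. j x > 0 \<longleftrightarrow> j y > 0)" for x y
    unfolding h_def using inj_on_image_eq_iff[OF enc, of "{j \<in> J. j x > 0}" "{j \<in> J. j y > 0}"] by blast
  have sep: "\<exists>k\<in>J. k y < 0 \<and> k x > 0" if j: "j \<in> J" "j x \<noteq> j y" for j x y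
  proof (cases "j y < j x")
    case True
    then obtain q where "j y < of_rat q" "of_rat q < j x" using of_rat_dense by blast
    then show ?thesis using J_diff[OF j(1), of q] by (intro bexI[of _ "\<lambda>x. j x - of_rat q"]) auto
  next
    case False
    then obtain q where "j x < of_rat q" "of_rat q < j y" using j of_rat_dense[of "j x" "j y"] by auto
    then show ?thesis using J_neg[OF J_diff[OF j(1), of q]]
      by (intro bexI[of _ "\<lambda>x. - (j x - of_rat q)"]) auto
  qed
  have h_eq: "j x = j y" if hj: "h x = h y" "j \<in> J" for j x y
  proof (rule ccontr)
    assume "j x \<noteq> j y"
    then obtain k where "k \<in> J" "k y < 0" "k x > 0" using sep[OF hj(2)] by blast
    then show False using hj(1) unfolding h_iff by force
  qed

  define C' where "C' = topology (\<lambda>W. W \<subseteq> h ` topspace C \<and> openin C {x \<in> topspace C. h x \<in> W})"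
  have "istopology (\<lambda>W. W \<subseteq> h ` topspace C \<and> openin C {x \<in> topspace C. h x \<in> W})"
    unfolding istopology_def
  proof (rule conjI; clarify)
    fix S T assume "openin C {x \<in> topspace C. h x \<in> S}" "openin C {x \<in> topspace C. h x \<in> T}"
      and sub: "S \<subseteq> h ` topspace C" 
    then have "openin C ({x \<in> topspace C. h x \<in> S} \<inter> {x \<in> topspace C. h x \<in> T})" by blast
    moreover have "{x \<in> topspace C. h x \<in> S} \<inter> {x \<in> topspace C. h x \<in> T} = {x \<in> topspace C. h x \<in> S \<inter> T}"
      by blast
    ultimately show "S \<inter> T \<subseteq> h ` topspace C \<and> openin C {x \<in> topspace C. h x \<in> S \<inter> T}"
      using sub by auto
  next
    fix \<K> assume K: "\<forall>K\<in>\<K>. K \<subseteq> h ` topspace C \<and> openin C {x \<in> topspace C. h x \<in> K}"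
    have "{x \<in> topspace C. h x \<in> \<Union>\<K>} = (\<Union>K\<in>\<K>. {x \<in> topspace C. h x \<in> K})" by blast
    then show "\<Union>\<K> \<subseteq> h ` topspace C \<and> openin C {x \<in> topspace C. h x \<in> \<Union>\<K>}" using K by auto
  qed
  then have openC': "openin C' W \<longleftrightarrow> W \<subseteq> h ` topspace C \<and> openin C {x \<in> topspace C. h x \<in> W}" for W
    unfolding C'_def by (simp add: topology_inverse')
  have topC': "topspace C' = h ` topspace C"
  proof
    show "topspace C' \<subseteq> h ` topspace C" using openC'[of "topspace C'"] by auto
    have "{x \<in> topspace C. h x \<in> h ` topspace C} = topspace C" by blast
    then have "openin C' (h ` topspace C)" unfolding openC' by auto
    then show "h ` topspace C \<subseteq> topspace C'" by (rule openin_subset)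
  qed
  have h_cont: "continuous_map C C' h"
    unfolding continuous_map_def using topC' openC' by auto
  have C'_compact: "compact_space C'"
    using image_compactin[of C "topspace C" C' h] C(1) h_cont topC' by (simp add: compact_space_def)
  have C'_Haus: "Hausdorff_space C'"
    unfolding Hausdorff_space_def
  proof (intro allI impI)
    fix z z' assume "z \<in> topspace C' \<and> z' \<in> topspace C' \<and> z \<noteq> z'"
    then obtain x y where xy: "x \<in> topspace C" "y \<in> topspace C" "z = h x" "z' = h y" "h x \<noteq> h y"
      unfolding topC' by blast
    then obtain j where "j \<in> J" "j x \<noteq> j y" unfolding h_iff by metis
    then obtain k where k: "k \<in> J" "k y < 0" "k x > 0" using sep by blast
    let ?G = "{x \<in> topspace C. k x > 0}" and ?L = "{x \<in> topspace C. k x < 0}"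
    have kG: "k u > 0" if hu: "h u \<in> h ` ?G" for u
    proof -
      obtain v where "h u = h v" "k v > 0" using hu by blast
      then show ?thesis using h_eq[of u v k] k(1) by simp
    qed
    have kL: "k u < 0" if hu: "h u \<in> h ` ?L" for u
    proof -
      obtain v where "h u = h v" "k v < 0" using hu by blast
      then show ?thesis using h_eq[of u v k] k(1) by simp
    qed
    have "{x \<in> topspace C. h x \<in> h ` ?G} = ?G" "{x \<in> topspace C. h x \<in> h ` ?L} = ?L"
      using kG kL by blast+
    then have "openin C' (h ` ?G)" "openin C' (h ` ?L)"
      unfolding openC' using open_gt open_lt J_ct k(1) by auto
    moreover have "disjnt (h ` ?G) (h ` ?L)"
    proof -
      have "h u \<notin> h ` ?L" if "u \<in> ?G" for u using kL[of u] that by auto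
      then show ?thesis unfolding disjnt_iff by blast
    qed
    ultimately show "\<exists>U V. openin C' U \<and> openin C' V \<and> z \<in> U \<and> z' \<in> V \<and> disjnt U V"
      using xy k by blast
  qed

  have fibre: "\<exists>k\<in>J. k y < 0 \<and> (\<forall>x\<in>topspace C. k x \<le> 0 \<longrightarrow> x \<in> W)"
    if W: "openin C W" "\<And>x. x \<in> topspace C \<Longrightarrow> h x = h y \<Longrightarrow> x \<in> W" for W y
  proof -
    let ?N = "\<lambda>k. {x \<in> topspace C. k x > 0}" and ?I = "{k \<in> J. k y < 0}"
    have "compactin C (topspace C - W)"
      using C(1) W(1) closedin_compact_space by blast
    moreover have "\<forall>N\<in>?N ` ?I. openin C N" using open_gt J_ct by blast
    moreover have "topspace C - W \<subseteq> \<Union>(?N ` ?I)"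
    proof
      fix x assume x: "x \<in> topspace C - W"
      then have "h x \<noteq> h y" using W(2) by blast
      then obtain j where "j \<in> J" "j x \<noteq> j y" unfolding h_iff by metis
      then obtain k where "k \<in> J" "k y < 0" "k x > 0" using sep by blast
      then show "x \<in> \<Union>(?N ` ?I)" using x by blast
    qed
    ultimately obtain \<F> where \<F>: "finite \<F>" "\<F> \<subseteq> ?N ` ?I" "topspace C - W \<subseteq> \<Union>\<F>"
      unfolding compactin_def by meson
    obtain I where I: "finite I" "I \<subseteq> ?I" "\<F> = ?N ` I"
      using finite_subset_image[OF \<F>(1,2)] by blast
    have "\<exists>k\<in>J. k y < 0 \<and> (\<forall>l\<in>I. \<forall>x. l x \<le> k x)"
      using I(1,2)
    proof (induction I rule: finite_induct)
      case empty
      have "(\<lambda>_. - 1) \<in> J" using J_diff[OF J_zero, of 1] by simp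
      then show ?case by (intro bexI[of _ "\<lambda>_. - 1"]) auto
    next
      case (insert l I)
      then obtain k where k: "k \<in> J" "k y < 0" "\<forall>l\<in>I. \<forall>x. l x \<le> k x" by auto
      have "(\<lambda>x. max (k x) (l x)) \<in> J" using J_max k(1) insert by blast
      moreover have "max (k y) (l y) < 0" using k insert by auto
      moreover have "\<forall>l'\<in>insert l I. \<forall>x. l' x \<le> max (k x) (l x)"
        using k(3) by (auto simp: le_max_iff_disj)
      ultimately show ?case by (intro bexI[of _ "\<lambda>x. max (k x) (l x)"]) auto
    qed
    then obtain k where k: "k \<in> J" "k y < 0" "\<forall>l\<in>I. \<forall>x. l x \<le> k x" by blast
    have "x \<in> W" if x: "x \<in> topspace C" "k x \<le> 0" for x
    proof (rule ccontr)
      assume "x \<notin> W"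
      then obtain l where "l \<in> I" "l x > 0" using \<F>(3) I(3) x(1) by blast
      then show False using k(3) x(2) by (metis dual_order.trans leD)
    qed
    with k show ?thesis by blast
  qed

  define valid where "valid z x \<longleftrightarrow> (\<exists>y\<in>topspace C. h y = z \<and> t y = x) \<and>
    (\<forall>V. openin X V \<and> x \<in> V \<longrightarrow> (\<forall>y\<in>topspace C. h y = z \<longrightarrow> t y \<in> V))" for z x
  have ex_valid: "\<exists>x. valid z x" if z: "z \<in> topspace C'" for z
  proof (rule ccontr)
    assume none: "\<not> ?thesis"
    obtain y0 where y0: "y0 \<in> topspace C" "z = h y0" using z topC' by blast
    let ?T = "t ` {y \<in> topspace C. h y = z}"
    have exV: "\<exists>V. openin X V \<and> x \<in> V \<and> (\<exists>y\<in>topspace C. h y = z \<and> t y \<notin> V)" if x: "x \<in> ?T" for x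
    proof -
      have "\<exists>y\<in>topspace C. h y = z \<and> t y = x" using x by blast
      moreover have "\<not> valid z x" using none by blast
      ultimately show ?thesis unfolding valid_def by blast
    qed
    define V where "V x = (SOME V. openin X V \<and> x \<in> V \<and> (\<exists>y\<in>topspace C. h y = z \<and> t y \<notin> V))" for x
    have V: "openin X (V x)" "x \<in> V x" "\<exists>y\<in>topspace C. h y = z \<and> t y \<notin> V x" if "x \<in> ?T" for x
      using someI_ex[OF exV[OF that]] unfolding V_def by blast+
    define R where "R = {(x, v). x \<in> ?T \<and> v \<in> V x}"
    have RI: "R `` {x} = (if x \<in> ?T then V x else {})" for x by (auto simp: R_def)
    have Ro: "\<forall>x. openin X (R `` {x})" using V(1) by (simp add: RI)
    have "openin X (\<Union>x. R `` {x})" using Ro by blast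
    then have "openin C (pre (\<Union>x. R `` {x}))" by (rule pre_open)
    moreover have "x \<in> pre (\<Union>x. R `` {x})" if "x \<in> topspace C" "h x = h y0" for x
    proof -
      have "t x \<in> ?T" using that y0 by blast
      then have "t x \<in> R `` {t x}" using V(2) unfolding RI by simp
      then show ?thesis using that(1) unfolding pre_def by blast
    qed
    ultimately obtain k where k: "k \<in> J" "k y0 < 0"
      "\<forall>x\<in>topspace C. k x \<le> 0 \<longrightarrow> x \<in> pre (\<Union>x. R `` {x})"
      using fibre[of "pre (\<Union>x. R `` {x})" y0] by blast
    have cov: "\<forall>y\<in>topspace C. k y \<le> 0 \<longrightarrow> (\<exists>x. t y \<in> R `` {x})"
      using k(3) unfolding pre_def by blast
    obtain n where n: "w R k n y0 > 0"
      using w_cov[OF J_ct[OF k(1)] Ro cov y0(1)] k(2) by auto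
    obtain x where x: "\<forall>y\<in>topspace C. w R k n y > 0 \<longrightarrow> t y \<in> R `` {x}"
      using w_sub[OF J_ct[OF k(1)] Ro cov] by blast
    have all: "t y \<in> R `` {x}" if "y \<in> topspace C" "h y = z" for y
      using x that h_eq[OF _ J_w[OF k(1)], of y y0 R n] n y0(2) by simp
    then have "x \<in> ?T" using y0 by (force simp: R_def)
    then show False using V(3) all unfolding RI by auto
  qed
  have valid_c: "valid (h c) (t c)"
    unfolding valid_def
  proof (intro conjI allI impI ballI)
    show "\<exists>y\<in>topspace C. h y = h c \<and> t y = t c" using c by blast
    fix V y assume V: "openin X V \<and> t c \<in> V" and y: "y \<in> topspace C" "h y = h c"
    have "c \<in> pre V" using c V by (simp add: pre_def)
    moreover have "openin C (pre V)" using V pre_open by blast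
    ultimately have "y \<in> pre V"
      using phi_pos[of "pre V" c] phi_sub[of "pre V" c y] h_eq[OF y(2) J_c[of V]] y(1) by simp
    then show "t y \<in> V" by (simp add: pre_def)
  qed
  have valid_a: "valid (h (a k)) (t (a k))" if "k \<in> J" "k c < 0" for k
    unfolding valid_def
  proof (intro conjI allI impI ballI)
    have ak: "a k \<in> topspace C" using a J_ct that by blast
    then show "\<exists>y\<in>topspace C. h y = h (a k) \<and> t y = t (a k)" by blast
    fix V y assume V: "openin X V \<and> t (a k) \<in> V" and y: "y \<in> topspace C" "h y = h (a k)"
    have "a k \<in> pre V" using ak V by (simp add: pre_def)
    moreover have "openin C (pre V)" using V pre_open by blast
    ultimately have "y \<in> pre V"
      using phi_pos[of "pre V" "a k"] phi_sub[of "pre V" "a k" y] h_eq[OF y(2) J_a[OF that(1), of V]] y(1)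
      by simp
    then show "t y \<in> V" by (simp add: pre_def)
  qed

  define t' where "t' z = (if z = h c then t c
    else if \<exists>x. valid z x \<and> x \<notin> U then SOME x. valid z x \<and> x \<notin> U else SOME x. valid z x)" for z
  have t'_c: "t' (h c) = t c" by (simp add: t'_def)
  have t'_nU: "valid z (t' z) \<and> t' z \<notin> U" if "z \<noteq> h c" "\<exists>x. valid z x \<and> x \<notin> U" for z
    using someI_ex[OF that(2)] that unfolding t'_def by presburger
  have t'_U: "t' z \<notin> U" if "z \<noteq> h c" "valid z x'" "x' \<notin> U" for z x'
    using t'_nU[OF that(1)] that by blast
  have t'_valid: "valid z (t' z)" if z: "z \<in> topspace C'" for z
  proof (cases "z = h c \<or> (\<exists>x. valid z x \<and> x \<notin> U)")
    case True
    then show ?thesis using t'_nU[of z] valid_c t'_c by (cases "z = h c") auto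
  next
    case False
    then have "z \<noteq> h c" "\<not> (\<exists>x. valid z x \<and> x \<notin> U)" by blast+
    then have "t' z = (SOME x. valid z x)" unfolding t'_def by (simp only: if_False)
    then show ?thesis using someI_ex[OF ex_valid[OF z]] by (simp only:)
  qed
  have "continuous_map C' X t'"
    unfolding continuous_map_def
  proof (intro conjI allI impI)
    show "t' \<in> topspace C' \<rightarrow> topspace X"
    proof
      fix z assume "z \<in> topspace C'"
      then obtain y where "y \<in> topspace C" "t y = t' z" using t'_valid unfolding valid_def by blast
      then show "t' z \<in> topspace X" using t by (metis continuous_map_def Pi_iff)
    qed
    fix V assume V: "openin X V"
    have "openin C {y \<in> topspace C. t' (h y) \<in> V}" (is "openin C ?S")
    proof (subst openin_subopen, intro ballI)
      fix y assume y: "y \<in> ?S"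
      have "h y \<in> topspace C'" using y topC' by blast
      then have "x \<in> pre V" if "x \<in> topspace C" "h x = h y" for x
        using t'_valid[of "h y"] y V that unfolding valid_def pre_def by blast
      then obtain k where k: "k \<in> J" "k y < 0" "\<forall>x\<in>topspace C. k x \<le> 0 \<longrightarrow> x \<in> pre V"
        using fibre[OF pre_open[OF V], of y] by blast
      have "{x \<in> topspace C. k x < 0} \<subseteq> ?S"
      proof clarify
        fix x assume x: "x \<in> topspace C" "k x < 0"
        then obtain x' where x': "x' \<in> topspace C" "h x' = h x" "t x' = t' (h x)"
          using t'_valid[of "h x"] topC' unfolding valid_def by blast
        then have "x' \<in> pre V" using k x h_eq[OF x'(2) k(1)] by force
        then show "t' (h x) \<in> V" using x x' by (simp add: pre_def)
      qed
      then show "\<exists>T. openin C T \<and> y \<in> T \<and> T \<subseteq> ?S"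
        using open_lt[OF J_ct[OF k(1)]] y k by blast
    qed
    moreover have "{x \<in> topspace C. h x \<in> {z \<in> topspace C'. t' z \<in> V}} = ?S" using topC' by blast
    ultimately show "openin C' {z \<in> topspace C'. t' z \<in> V}"
      unfolding openC' using topC' by auto
  qed
  then have "openin C' {z \<in> topspace C'. t' z \<in> U}"
    using U C'_compact C'_Haus unfolding openin_kify by blast
  then have "openin C {x \<in> topspace C. h x \<in> {z \<in> topspace C'. t' z \<in> U}}"
    unfolding openC' by blast
  moreover have "{x \<in> topspace C. h x \<in> {z \<in> topspace C'. t' z \<in> U}} = {x \<in> topspace C. t' (h x) \<in> U}"
    using topC' by blast
  ultimately have O: "openin C {x \<in> topspace C. t' (h x) \<in> U}" by simp
  have "x \<in> {x \<in> topspace C. t' (h x) \<in> U}" if "x \<in> topspace C" "h x = h c" for x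
    using that t'_c c by simp
  then obtain k where k: "k \<in> J" "k c < 0" "\<forall>x\<in>topspace C. k x \<le> 0 \<longrightarrow> t' (h x) \<in> U"
    using fibre[OF O, of c] by blast
  have ak: "a k \<in> topspace C" "k (a k) < 0" "t (a k) \<notin> U" using a J_ct k by blast+
  have "openin C (topspace C - {a k})"
    using C(2) ak(1) by (simp add: Hausdorff_imp_t1_space openin_diff closedin_t1_singleton)
  moreover have "c \<in> topspace C - {a k}" using c ak by auto
  ultimately have "phi (topspace C - {a k}) c c > 0" "\<not> phi (topspace C - {a k}) c (a k) > 0"
    using phi_pos[of "topspace C - {a k}" c] phi_sub[of "topspace C - {a k}" c "a k"] ak(1) by blast+
  then have "h (a k) \<noteq> h c" using J_sep[OF k(1)] unfolding h_iff by blast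
  then have "t' (h (a k)) \<notin> U" using t'_U valid_a k ak(3) by blast
  then show False using k(3) ak by auto
qed


section \<open>Constructions on k-spaces\<close>

definition k_prod :: "'a topology \<Rightarrow> 'b topology \<Rightarrow> ('a \<times> 'b) topology" where
  "k_prod X Y = kify (prod_topology X Y)"

definition k_pullback ::
  "'x topology \<Rightarrow> ('x \<Rightarrow> 'b) \<Rightarrow> 'y topology \<Rightarrow> ('y \<Rightarrow> 'b) \<Rightarrow> ('x \<times> 'y) topology" where
  "k_pullback X p Y q = kify (subtopology (prod_topology X Y) {(x, y). p x = q y})"

definition weak_Hausdorff :: "'b topology \<Rightarrow> bool" where
  "weak_Hausdorff B \<longleftrightarrow> closedin (k_prod B B) {(b, b) |b. b \<in> topspace B}"

text \<open>
  Maps out of a space are represented by functions that are \<open>undefined\<close> off its carrier, so that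
  equality of functions is equality of maps.
\<close>

definition cont_maps :: "'a topology \<Rightarrow> 'b topology \<Rightarrow> ('a \<Rightarrow> 'b) set" where
  "cont_maps Y Z = {f \<in> extensional (topspace Y). continuous_map Y Z f}"

definition compact_open_topology :: "'a topology \<Rightarrow> 'b topology \<Rightarrow> ('a \<Rightarrow> 'b) topology" where
  "compact_open_topology Y Z = topology_generated_by
     {{f \<in> cont_maps Y Z. f ` K \<subseteq> U} |K U. compactin Y K \<and> openin Z U}"

definition mapping_space :: "'a topology \<Rightarrow> 'b topology \<Rightarrow> ('a \<Rightarrow> 'b) topology" where
  "mapping_space Y Z = kify (compact_open_topology Y Z)"

lemma topspace_mapping_space: "topspace (mapping_space Y Z) = cont_maps Y Z"
proof -
  have "\<Union>{{f \<in> cont_maps Y Z. f ` K \<subseteq> U} |K U. compactin Y K \<and> openin Z U} = cont_maps Y Z"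
    (is "\<Union>?S = _")
  proof
    have "cont_maps Y Z \<in> ?S"
      by (rule CollectI, rule exI[of _ "{}"], rule exI[of _ "{}"]) auto
    then show "cont_maps Y Z \<subseteq> \<Union>?S" by blast
  qed blast
  then show ?thesis
    by (simp add: mapping_space_def compact_open_topology_def)
qed

section \<open>The free range mapping space\<close>

text \<open>\<open>Z\<^sup>\<sim>\<close>, with \<open>None\<close> as the added point.\<close>

definition tilde :: "'z topology \<Rightarrow> 'z option topology" where
  "tilde Z = topology (\<lambda>U. U = {} \<or> (\<exists>V. openin Z V \<and> U = insert None (Some ` V)))"

lemma openin_tilde: "openin (tilde Z) U \<longleftrightarrow> U = {} \<or> (\<exists>V. openin Z V \<and> U = insert None (Some ` V))"
proof -
  have "istopology (\<lambda>U. U = {} \<or> (\<exists>V. openin Z V \<and> U = insert None (Some ` V)))" (is "istopology ?P")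
    unfolding istopology_def
  proof (intro conjI allI impI)
    fix S T assume ST: "?P S" "?P T"
    show "?P (S \<inter> T)"
    proof (cases "S = {} \<or> T = {}")
      case False
      then obtain V W where "openin Z V" "S = insert None (Some ` V)"
        and "openin Z W" "T = insert None (Some ` W)" using ST by blast
      then show ?thesis by (intro disjI2 exI[of _ "V \<inter> W"]) auto
    qed auto
  next
    fix \<K> assume K: "\<forall>K\<in>\<K>. ?P K"
    show "?P (\<Union>\<K>)"
    proof (cases "\<Union>\<K> = {}")
      case False
      define V where "V = \<Union>{V. openin Z V \<and> insert None (Some ` V) \<in> \<K>}"
      have "openin Z V" unfolding V_def by blast
      moreover have "\<Union>\<K> = insert None (Some ` V)"
      proof
        show "\<Union>\<K> \<subseteq> insert None (Some ` V)"
        proof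
          fix x assume "x \<in> \<Union>\<K>"
          then obtain K where x: "x \<in> K" "K \<in> \<K>" by blast
          then obtain W where "openin Z W" "K = insert None (Some ` W)" using K by blast
          with x show "x \<in> insert None (Some ` V)" unfolding V_def by blast
        qed
        obtain K where "K \<in> \<K>" "K \<noteq> {}" using False by blast
        then have "None \<in> \<Union>\<K>" using K by blast
        then show "insert None (Some ` V) \<subseteq> \<Union>\<K>" unfolding V_def by blast
      qed
      ultimately show ?thesis by blast
    qed simp
  qed
  then show ?thesis by (simp add: tilde_def topology_inverse')
qed

lemma topspace_tilde: "topspace (tilde Z) = insert None (Some ` topspace Z)"
proof
  show "topspace (tilde Z) \<subseteq> insert None (Some ` topspace Z)"
    using openin_topspace[of "tilde Z"] openin_subset[of Z] unfolding openin_tilde by blast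
  have "openin (tilde Z) (insert None (Some ` topspace Z))"
    unfolding openin_tilde by blast
  then show "insert None (Some ` topspace Z) \<subseteq> topspace (tilde Z)"
    by (rule openin_subset)
qed

lemma closedin_tilde:
  "closedin (tilde Z) F \<longleftrightarrow> F = topspace (tilde Z) \<or> (\<exists>G. closedin Z G \<and> F = Some ` G)"
proof
  assume F: "closedin (tilde Z) F"
  then have sub: "F \<subseteq> topspace (tilde Z)" and "openin (tilde Z) (topspace (tilde Z) - F)"
    by (auto simp: closedin_def)
  then consider "topspace (tilde Z) - F = {}"
    | V where "openin Z V" "topspace (tilde Z) - F = insert None (Some ` V)"
    unfolding openin_tilde by blast
  then show "F = topspace (tilde Z) \<or> (\<exists>G. closedin Z G \<and> F = Some ` G)"
  proof cases
    case 1
    then show ?thesis using sub by blast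
  next
    case 2
    have "F = topspace (tilde Z) - insert None (Some ` V)" using 2 sub by blast
    then have "F = Some ` (topspace Z - V)" unfolding topspace_tilde by auto
    then show ?thesis using 2(1) by blast
  qed
next
  assume "F = topspace (tilde Z) \<or> (\<exists>G. closedin Z G \<and> F = Some ` G)"
  then show "closedin (tilde Z) F"
  proof
    assume "\<exists>G. closedin Z G \<and> F = Some ` G"
    then obtain G where G: "closedin Z G" "F = Some ` G" by blast
    then have "G \<subseteq> topspace Z" by (simp add: closedin_subset)
    moreover have "topspace (tilde Z) - F = insert None (Some ` (topspace Z - G))"
      using G(2) unfolding topspace_tilde by auto
    moreover have "openin Z (topspace Z - G)" using G(1) by blast
    ultimately show ?thesis
      using G(2) unfolding closedin_def openin_tilde topspace_tilde by auto
  qed simp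
qed

definition fibre_space :: "'y topology \<Rightarrow> ('y \<Rightarrow> 'b) \<Rightarrow> 'b \<Rightarrow> 'y topology" where
  "fibre_space Y q b = kify (subtopology Y {y. q y = b})"

text \<open>
  A map \<open>f : Y|b \<rightarrow> Z\<close> is represented as the pair \<open>(b, f)\<close>; the tag \<open>b\<close> makes the union over the
  fibres disjoint (all empty fibres carry the same empty map).
\<close>

definition free_range_carrier ::
  "'y topology \<Rightarrow> ('y \<Rightarrow> 'b) \<Rightarrow> 'b topology \<Rightarrow> 'z topology \<Rightarrow> ('b \<times> ('y \<Rightarrow> 'z)) set" where
  "free_range_carrier Y q B Z = (SIGMA b : topspace B. cont_maps (fibre_space Y q b) Z)"

definition free_range_proj :: "'b \<times> ('y \<Rightarrow> 'z) \<Rightarrow> 'b" where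
  "free_range_proj g = fst g"

definition free_range_ext ::
  "'y topology \<Rightarrow> ('y \<Rightarrow> 'b) \<Rightarrow> 'b \<times> ('y \<Rightarrow> 'z) \<Rightarrow> ('y \<Rightarrow> 'z option)" where
  "free_range_ext Y q g = (\<lambda>y\<in>topspace Y. if q y = fst g then Some (snd g y) else None)"

definition free_range_space ::
  "'y topology \<Rightarrow> ('y \<Rightarrow> 'b) \<Rightarrow> 'b topology \<Rightarrow> 'z topology \<Rightarrow> ('b \<times> ('y \<Rightarrow> 'z)) topology" where
  "free_range_space Y q B Z = kify (topology_generated_by
     ({{g \<in> free_range_carrier Y q B Z. free_range_ext Y q g \<in> W} |W.
         openin (mapping_space Y (tilde Z)) W} \<union>
      {{g \<in> free_range_carrier Y q B Z. free_range_proj g \<in> V} |V. openin B V}))"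

lemma topspace_free_range_space: "topspace (free_range_space Y q B Z) = free_range_carrier Y q B Z"
  (is "_ = ?E")
proof -
  have "?E \<subseteq> {g \<in> ?E. free_range_proj g \<in> topspace B}"
    unfolding free_range_carrier_def free_range_proj_def by auto
  then show ?thesis
    unfolding free_range_space_def topspace_kify topology_generated_by_topspace
    using openin_topspace[of B] by blast
qed

definition fibrewise_maps ::
  "'x topology \<Rightarrow> ('x \<Rightarrow> 'b) \<Rightarrow> 'e topology \<Rightarrow> ('e \<Rightarrow> 'b) \<Rightarrow> ('x \<Rightarrow> 'e) set" where
  "fibrewise_maps X p E \<pi> = {g \<in> cont_maps X E. \<forall>x\<in>topspace X. \<pi> (g x) = p x}"

text \<open>The rule \<open>f\<^sup>>(x, y) = f\<^sup><(x)(y)\<close>, as a function of \<open>f\<^sup><\<close>.\<close>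

definition uncurry_fibrewise ::
  "'x topology \<Rightarrow> ('x \<Rightarrow> 'b) \<Rightarrow> 'y topology \<Rightarrow> ('y \<Rightarrow> 'b) \<Rightarrow>
   ('x \<Rightarrow> 'b \<times> ('y \<Rightarrow> 'z)) \<Rightarrow> ('x \<times> 'y \<Rightarrow> 'z)" where
  "uncurry_fibrewise X p Y q g = (\<lambda>(x, y)\<in>topspace (k_pullback X p Y q). snd (g x) y)"

end

theory Submission
  imports Defs
begin

text \<open>
  Everything is tested on compact Hausdorff spaces \<open>C\<close>. For such \<open>C\<close> and a k-space \<open>Y\<close> the ordinary
  product \<open>C \<times> Y\<close> is already a k-space, so the tube lemma makes currying continuous even though the
  compact-open topology here uses compact sets that need not be Hausdorff; evaluation is continuous
  because \<open>C\<close> is regular. A map \<open>X \<sqinter> Y \<rightarrow> Z\<close> extends by \<open>\<omega>\<close> to a continuous map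
  \<open>X \<times> Y \<rightarrow> Z\<^sup>\<sim>\<close>, since the pullback meets every test space of \<open>X \<times> Y\<close> in a closed set by weak
  Hausdorffness of \<open>B\<close>; the theorem is then the exponential law for \<open>X \<times> Y \<rightarrow> Z\<^sup>\<sim>\<close>.
\<close>

section \<open>Continuity and k-ification\<close>

lemma openin_imp_openin_kify:
  assumes "openin X U"
  shows "openin (kify X) U"
  unfolding openin_kify
  by (auto intro: openin_continuous_map_preimage[OF _ assms] dest: openin_subset[OF assms, THEN subsetD])

lemma continuous_map_kify_id: "continuous_map (kify X) X (\<lambda>x. x)"
  using openin_imp_openin_kify[of X] openin_subset[of X]
  by (simp add: continuous_map_def Collect_conj_eq Int_absorb1)

lemma continuous_map_into_kify_imp:
  assumes "continuous_map A (kify X) f"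
  shows "continuous_map A X f"
  using continuous_map_compose[OF assms continuous_map_kify_id] by (simp add: o_def)

text \<open>Here \<open>C\<close> may live on any type, although \<open>kify\<close> tests against a
  single one; \<open>openin_kify_preimage\<close> supplies the transfer.\<close>

lemma continuous_map_from_compact_Hausdorff_into_kify:
  assumes "compact_space C" "Hausdorff_space C" "continuous_map C X t"
  shows "continuous_map C (kify X) t"
  using assms(3) openin_kify_preimage[OF _ assms] by (simp add: continuous_map_def)

text \<open>The universal property of the final topology. It lets currying, evaluation and extension
  by the added point be checked on compact Hausdorff spaces.\<close>

lemma continuous_map_from_kifyI:
  fixes X :: "'a topology"
  assumes test: "\<And>(C :: ('a + nat) set set topology) t.
    compact_space C \<Longrightarrow> Hausdorff_space C \<Longrightarrow> continuous_map C X t \<Longrightarrow> continuous_map C Z (\<lambda>c. f (t c))"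
  shows "continuous_map (kify X) Z f"
  unfolding continuous_map_def
proof (intro conjI allI impI)
  show "f \<in> topspace (kify X) \<rightarrow> topspace Z"
  proof
    fix x assume "x \<in> topspace (kify X)"
    \<comment> \<open>A one-point test space, with point \<open>{}\<close>, reaches each
      \<open>x\<close>, so the test hypothesis also places \<open>f x\<close> in
      \<open>Z\<close>.\<close>
    then have "continuous_map (discrete_topology {{}}) X (\<lambda>_ :: ('a + nat) set set. x)" by simp
    then have "continuous_map (discrete_topology {{}}) Z (\<lambda>_ :: ('a + nat) set set. f x)"
      by (intro test) (auto simp: compact_space_discrete_topology)
    then show "f x \<in> topspace Z" unfolding continuous_map_def by fastforce
  qed
next
  fix U assume U: "openin Z U"
  show "openin (kify X) {x \<in> topspace (kify X). f x \<in> U}"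
    unfolding openin_kify
  proof (intro conjI allI impI; (elim conjE)?)
    fix C :: "('a + nat) set set topology" and t
    assume C: "compact_space C" "Hausdorff_space C" "continuous_map C X t"
    have "{c \<in> topspace C. t c \<in> {x \<in> topspace (kify X). f x \<in> U}} = {c \<in> topspace C. f (t c) \<in> U}"
      using C(3) by (auto simp: continuous_map_def)
    then show "openin C {c \<in> topspace C. t c \<in> {x \<in> topspace (kify X). f x \<in> U}}"
      using openin_continuous_map_preimage[OF test[OF C] U] by simp
  qed auto
qed

text \<open>Composing with \<open>f\<close> turns test maps into \<open>X\<close> into test maps
  into \<open>Y\<close>. Hence the target may be k-ified freely once the source is a
  k-space.\<close>

lemma continuous_map_into_kify:
  fixes X :: "'a topology"
  assumes "is_k_space X" "continuous_map X Y f"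
  shows "continuous_map X (kify Y) f"
proof -
  have "continuous_map (kify X) (kify Y) f"
  proof (rule continuous_map_from_kifyI)
    fix C :: "('a + nat) set set topology" and t
    assume C: "compact_space C" "Hausdorff_space C" "continuous_map C X t"
    then have "continuous_map C Y (\<lambda>c. f (t c))"
      using continuous_map_compose[OF C(3) assms(2)] by (simp add: o_def)
    then show "continuous_map C (kify Y) (\<lambda>c. f (t c))"
      using C by (intro continuous_map_from_compact_Hausdorff_into_kify)
  qed
  then show ?thesis using assms(1) by (simp add: is_k_space_def)
qed

text \<open>\<open>X\<close> and \<open>kify X\<close> admit the same test maps, so a second
  k-ification adds no open sets.\<close>

lemma is_k_space_kify: "is_k_space (kify X)"
proof -
  have "openin (kify (kify X)) U \<longleftrightarrow> openin (kify X) U" for U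
    unfolding openin_kify[of "kify X"] openin_kify[of X] topspace_kify
    by (meson continuous_map_from_compact_Hausdorff_into_kify continuous_map_into_kify_imp)
  then show ?thesis
    unfolding is_k_space_def by (simp add: topology_eq)
qed

lemma is_k_spaceI:
  assumes "\<And>U. openin (kify X) U \<Longrightarrow> openin X U"
  shows "is_k_space X"
  using assms openin_imp_openin_kify unfolding is_k_space_def topology_eq by blast

section \<open>Tubes and products with compact Hausdorff spaces\<close>

lemma compact_Hausdorff_compact_neighbourhood:
  assumes "compact_space C" "Hausdorff_space C" "openin C W" "c \<in> W"
  obtains N K where "openin C N" "compactin C K" "c \<in> N" "N \<subseteq> K" "K \<subseteq> W"
proof -
  \<comment> \<open>Compact Hausdorff spaces are regular, and their closed neighbourhoods are
    compact.\<close>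
  have "neighbourhood_base_of (closedin C) C"
    using assms by (simp add: neighbourhood_base_of_closedin compact_Hausdorff_imp_regular_space)
  then show thesis
    using assms(3,4) closedin_compact_space[OF assms(1)] that unfolding neighbourhood_base_of by meson
qed

text \<open>The tube lemma: Wallace's theorem for the compact sets \<open>{x}\<close> and
  \<open>K\<close>.\<close>

lemma openin_tube:
  assumes W: "openin (prod_topology X Y) W" and K: "compactin Y K"
  shows "openin X {x \<in> topspace X. \<forall>y\<in>K. (x, y) \<in> W}"
proof (subst openin_subopen, intro ballI)
  fix x assume x: "x \<in> {x \<in> topspace X. \<forall>y\<in>K. (x, y) \<in> W}"
  then have "compactin X {x}" "{x} \<times> K \<subseteq> W" by auto
  then obtain U V where "openin X U" "{x} \<subseteq> U" "K \<subseteq> V" "U \<times> V \<subseteq> W"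
    using Wallace_theorem_prod_topology[OF _ K W] by metis
  then show "\<exists>T. openin X T \<and> x \<in> T \<and> T \<subseteq> {x \<in> topspace X. \<forall>y\<in>K. (x, y) \<in> W}"
    using openin_subset[of X U] by (intro exI[of _ U]) auto
qed

text \<open>Around \<open>(c, y)\<close> a box is built from a compact neighbourhood
  \<open>K\<close> of \<open>c\<close> inside the slice of \<open>U\<close> at \<open>y\<close>, and
  from the points of \<open>Y\<close> over which all of \<open>K\<close> stays in
  \<open>U\<close>.\<close>

lemma is_k_space_prod_compact_Hausdorff:
  fixes C :: "'c topology" and Y :: "'y topology"
  assumes C: "compact_space C" "Hausdorff_space C" and Y: "is_k_space Y"
  shows "is_k_space (prod_topology C Y)"
proof (rule is_k_spaceI)
  fix U assume U: "openin (kify (prod_topology C Y)) U"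
  then have U_sub: "U \<subseteq> topspace C \<times> topspace Y" by (auto simp: openin_kify)
  show "openin (prod_topology C Y) U"
    unfolding openin_prod_topology_alt
  proof (intro allI impI)
    fix c y assume cy: "(c, y) \<in> U"
    have "continuous_map C (prod_topology C Y) (\<lambda>x. (x, y))"
      using cy U_sub by (intro continuous_intros) auto
    then have "openin C {x \<in> topspace C. (x, y) \<in> U}" by (rule openin_kify_preimage[OF U C])
    moreover have "c \<in> {x \<in> topspace C. (x, y) \<in> U}" using cy U_sub by auto
    ultimately obtain N K where
      N: "openin C N" "compactin C K" "c \<in> N" "N \<subseteq> K" "K \<subseteq> {x \<in> topspace C. (x, y) \<in> U}"
      by (rule compact_Hausdorff_compact_neighbourhood[OF C])
    \<comment> \<open>It suffices that \<open>V\<close> be open in \<open>kify Y\<close>, since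
      \<open>Y\<close> is a k-space.\<close>
    define V where "V = {v \<in> topspace Y. \<forall>x\<in>K. (x, v) \<in> U}"
    have "openin (kify Y) V"
      unfolding openin_kify
    proof (intro conjI allI impI; (elim conjE)?)
      fix D :: "('y + nat) set set topology" and s
      assume D: "compact_space D" "Hausdorff_space D" and s: "continuous_map D Y s"
      \<comment> \<open>A test \<open>s\<close> of \<open>Y\<close> yields the test space
        \<open>prod_topology D C\<close> of the product. Its type differs from the one fixed in
        \<open>kify\<close>, so \<open>openin_kify_preimage\<close> is essential; the tube lemma
        along \<open>K\<close> then gives openness in \<open>D\<close>.\<close>
      have "continuous_map (prod_topology D C) (prod_topology C Y) (\<lambda>z. (snd z, s (fst z)))"
        using continuous_map_compose[OF continuous_map_fst s]
        by (intro continuous_intros continuous_map_snd) (simp add: o_def)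
      moreover have "compact_space (prod_topology D C)" "Hausdorff_space (prod_topology D C)"
        using C D by (auto simp: compact_space_prod_topology Hausdorff_space_prod_topology)
      ultimately have "openin (prod_topology D C)
          {z \<in> topspace (prod_topology D C). (snd z, s (fst z)) \<in> U}"
        by (intro openin_kify_preimage[OF U])
      from openin_tube[OF this N(2)]
      have "openin D {d \<in> topspace D. \<forall>x\<in>K. (d, x) \<in>
          {z \<in> topspace (prod_topology D C). (snd z, s (fst z)) \<in> U}}" .
      also have "{d \<in> topspace D. \<forall>x\<in>K. (d, x) \<in>
          {z \<in> topspace (prod_topology D C). (snd z, s (fst z)) \<in> U}} = {d \<in> topspace D. s d \<in> V}"
        using s compactin_subset_topspace[OF N(2)] by (auto simp: V_def continuous_map_def)
      finally show "openin D {d \<in> topspace D. s d \<in> V}" .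
    qed (auto simp: V_def)
    then have "openin Y V" using Y by (simp add: is_k_space_def)
    then show "\<exists>U' V. openin C U' \<and> openin Y V \<and> c \<in> U' \<and> y \<in> V \<and> U' \<times> V \<subseteq> U"
      using N cy U_sub by (intro exI[of _ N] exI[of _ V]) (auto simp: V_def)
  qed
qed

section \<open>The exponential law\<close>

lemma topspace_compact_open_topology: "topspace (compact_open_topology Y Z) = cont_maps Y Z"
  using topspace_mapping_space[of Y Z] by (simp add: mapping_space_def)

lemma continuous_map_into_compact_open:
  assumes "\<And>x. x \<in> topspace X \<Longrightarrow> g x \<in> cont_maps Y Z"
    and "\<And>K U. compactin Y K \<Longrightarrow> openin Z U \<Longrightarrow> openin X {x \<in> topspace X. g x ` K \<subseteq> U}"
  shows "continuous_map X (compact_open_topology Y Z) g"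
  unfolding compact_open_topology_def
proof (rule continuous_on_generated_topo)
  show "g ` topspace X \<subseteq> \<Union>{{f \<in> cont_maps Y Z. f ` K \<subseteq> U} |K U. compactin Y K \<and> openin Z U}"
    using assms(1) topspace_compact_open_topology[of Y Z]
    by (auto simp: compact_open_topology_def)
next
  fix W assume "W \<in> {{f \<in> cont_maps Y Z. f ` K \<subseteq> U} |K U. compactin Y K \<and> openin Z U}"
  then obtain K U where KU: "compactin Y K" "openin Z U" "W = {f \<in> cont_maps Y Z. f ` K \<subseteq> U}" by blast
  then have "g -` W \<inter> topspace X = {x \<in> topspace X. g x ` K \<subseteq> U}" using assms(1) by auto
  then show "openin X (g -` W \<inter> topspace X)" using assms(2) KU by simp
qed

text \<open>After testing, \<open>X\<close> is replaced by a compact Hausdorff \<open>C\<close>. The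
  ordinary product of \<open>C\<close> and \<open>Y\<close> is a k-space, so \<open>F\<close> pulls
  back to a continuous map on it, where the tube lemma applies to every compact
  \<open>K\<close>.\<close>

lemma continuous_map_curry:
  fixes X :: "'x topology" and Y :: "'y topology"
  assumes X: "is_k_space X" and Y: "is_k_space Y" and F: "continuous_map (k_prod X Y) Z F"
  shows "continuous_map X (mapping_space Y Z) (\<lambda>x. \<lambda>y\<in>topspace Y. F (x, y))"
proof -
  have sec: "(\<lambda>y\<in>topspace Y. F (x, y)) \<in> cont_maps Y Z" if "x \<in> topspace X" for x
  proof -
    have "continuous_map Y (prod_topology X Y) (\<lambda>y. (x, y))"
      using that by (intro continuous_intros) auto
    then have "continuous_map Y (k_prod X Y) (\<lambda>y. (x, y))"
      unfolding k_prod_def by (rule continuous_map_into_kify[OF Y])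
    from continuous_map_compose[OF this F]
    have "continuous_map Y Z (\<lambda>y\<in>topspace Y. F (x, y))" by (rule continuous_map_eq) auto
    then show ?thesis by (simp add: cont_maps_def)
  qed
  have "continuous_map (kify X) (compact_open_topology Y Z) (\<lambda>x. \<lambda>y\<in>topspace Y. F (x, y))"
  proof (rule continuous_map_from_kifyI)
    fix C :: "('x + nat) set set topology" and t
    assume C: "compact_space C" "Hausdorff_space C" and t: "continuous_map C X t"
    have "continuous_map (prod_topology C Y) (prod_topology X Y) (\<lambda>z. (t (fst z), snd z))"
      using continuous_map_compose[OF continuous_map_fst t]
      by (intro continuous_intros continuous_map_snd) (simp add: o_def)
    then have "continuous_map (prod_topology C Y) (k_prod X Y) (\<lambda>z. (t (fst z), snd z))"
      unfolding k_prod_def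
      by (rule continuous_map_into_kify[OF is_k_space_prod_compact_Hausdorff[OF C Y]])
    from continuous_map_compose[OF this F]
    have G: "continuous_map (prod_topology C Y) Z (\<lambda>z. F (t (fst z), snd z))" by (simp add: o_def)
    show "continuous_map C (compact_open_topology Y Z) (\<lambda>c. \<lambda>y\<in>topspace Y. F (t c, y))"
    proof (rule continuous_map_into_compact_open)
      show "(\<lambda>y\<in>topspace Y. F (t c, y)) \<in> cont_maps Y Z" if "c \<in> topspace C" for c
        using that t by (intro sec) (auto simp: continuous_map_def)
    next
      fix K U assume K: "compactin Y K" and U: "openin Z U"
      \<comment> \<open>The preimage of a subbasic set is a tube over \<open>K\<close>.\<close>
      have "{c \<in> topspace C. (\<lambda>y\<in>topspace Y. F (t c, y)) ` K \<subseteq> U} =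
        {c \<in> topspace C. \<forall>y\<in>K. (c, y) \<in> {z \<in> topspace (prod_topology C Y). F (t (fst z), snd z) \<in> U}}"
        using compactin_subset_topspace[OF K] by (auto simp: image_subset_iff)
      then show "openin C {c \<in> topspace C. (\<lambda>y\<in>topspace Y. F (t c, y)) ` K \<subseteq> U}"
        using openin_tube[OF openin_continuous_map_preimage[OF G U] K] by simp
    qed
  qed
  then show ?thesis
    using X continuous_map_into_kify[OF X] by (simp add: is_k_space_def mapping_space_def)
qed

text \<open>A test space maps to pairs \<open>(g c, s c)\<close>. Local compactness of
  \<open>C\<close> gives a compact set on which \<open>s\<close> can vary, and its image in
  \<open>Y\<close> is a compact set defining a subbasic neighbourhood of \<open>g c\<close>.\<close>

lemma continuous_map_eval:
  fixes Y :: "'y topology" and Z :: "'z topology"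
  shows "continuous_map (k_prod (mapping_space Y Z) Y) Z (\<lambda>(g, y). g y)"
  unfolding k_prod_def
proof (rule continuous_map_from_kifyI)
  fix C :: "(('y \<Rightarrow> 'z) \<times> 'y + nat) set set topology" and t
  assume C: "compact_space C" "Hausdorff_space C"
    and t: "continuous_map C (prod_topology (mapping_space Y Z) Y) t"
  define g s where "g = fst \<circ> t" and "s = snd \<circ> t"
  have g: "continuous_map C (compact_open_topology Y Z) g" and s: "continuous_map C Y s"
    using t unfolding continuous_map_pairwise g_def s_def mapping_space_def
    by (auto intro: continuous_map_into_kify_imp)
  have gm: "g c \<in> cont_maps Y Z" if "c \<in> topspace C" for c
    using g that by (auto simp: continuous_map_def topspace_compact_open_topology)
  have "continuous_map C Z (\<lambda>c. g c (s c))"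
    unfolding continuous_map_def
  proof (intro conjI allI impI)
    show "(\<lambda>c. g c (s c)) \<in> topspace C \<rightarrow> topspace Z"
      using gm s by (fastforce simp: cont_maps_def continuous_map_def)
    fix U assume U: "openin Z U"
    show "openin C {c \<in> topspace C. g c (s c) \<in> U}"
    proof (subst openin_subopen, intro ballI)
      fix c assume c: "c \<in> {c \<in> topspace C. g c (s c) \<in> U}"
      \<comment> \<open>The map \<open>g c\<close> is frozen first, so that \<open>K\<close> is
        chosen for the argument alone; the subbasic set below then controls the variation of
        \<open>g\<close>.\<close>
      then have "continuous_map C Z (\<lambda>d. g c (s d))"
        using continuous_map_compose[OF s, of Z "g c"] gm[of c] by (simp add: cont_maps_def o_def)
      from openin_continuous_map_preimage[OF this U] obtain N K where
        N: "openin C N" "compactin C K" "c \<in> N" "N \<subseteq> K" "K \<subseteq> {d \<in> topspace C. g c (s d) \<in> U}"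
        using compact_Hausdorff_compact_neighbourhood[OF C] c
        by (metis (mono_tags, lifting) mem_Collect_eq)
      have "openin (compact_open_topology Y Z) {f \<in> cont_maps Y Z. f ` (s ` K) \<subseteq> U}"
        unfolding compact_open_topology_def using image_compactin[OF N(2) s] U
        by (intro topology_generated_by_Basis) blast
      from openin_continuous_map_preimage[OF g this]
      have "openin C ({d \<in> topspace C. g d \<in> {f \<in> cont_maps Y Z. f ` (s ` K) \<subseteq> U}} \<inter> N)"
        using N(1) by blast
      moreover have "c \<in> {d \<in> topspace C. g d \<in> {f \<in> cont_maps Y Z. f ` (s ` K) \<subseteq> U}} \<inter> N"
        using c N gm[of c] by auto
      ultimately show "\<exists>T. openin C T \<and> c \<in> T \<and> T \<subseteq> {c \<in> topspace C. g c (s c) \<in> U}"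
        using N(4) by (intro exI conjI) (assumption, assumption, auto)
    qed
  qed
  then show "continuous_map C Z (\<lambda>c. case t c of (g, y) \<Rightarrow> g y)"
    by (simp add: g_def s_def case_prod_unfold)
qed

lemma continuous_map_uncurry:
  assumes "continuous_map A (mapping_space Y Z) g" "continuous_map A Y s" "is_k_space A"
  shows "continuous_map A Z (\<lambda>a. g a (s a))"
proof -
  have "continuous_map A (k_prod (mapping_space Y Z) Y) (\<lambda>a. (g a, s a))"
    unfolding k_prod_def using assms by (intro continuous_map_into_kify continuous_intros)
  from continuous_map_compose[OF this continuous_map_eval] show ?thesis by (simp add: o_def)
qed

section \<open>Partial maps and the free range mapping space\<close>

text \<open>\<open>Some\<close> embeds \<open>Z\<close> as a subspace of \<open>tilde Z\<close>: the
  nonempty open sets of \<open>tilde Z\<close> trace out exactly the open sets of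
  \<open>Z\<close>.\<close>

lemma continuous_map_tilde_Some_iff:
  "continuous_map X (tilde Z) (\<lambda>x. Some (f x)) \<longleftrightarrow> continuous_map X Z f"
proof -
  have "(\<lambda>x. Some (f x)) \<in> topspace X \<rightarrow> topspace (tilde Z) \<longleftrightarrow> f \<in> topspace X \<rightarrow> topspace Z"
    by (auto simp: topspace_tilde Pi_iff)
  moreover have "(\<forall>U. openin (tilde Z) U \<longrightarrow> openin X {x \<in> topspace X. Some (f x) \<in> U}) \<longleftrightarrow>
      (\<forall>V. openin Z V \<longrightarrow> openin X {x \<in> topspace X. Some (f x) \<in> insert None (Some ` V)})"
    unfolding openin_tilde by (simp del: insert_iff add: all_conj_distrib imp_disjL imp_ex)
  moreover have "{x \<in> topspace X. Some (f x) \<in> insert None (Some ` V)} = {x \<in> topspace X. f x \<in> V}" for V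
    by auto
  ultimately show ?thesis
    by (simp add: continuous_map_def)
qed

section \<open>Pullbacks and extension by the added point\<close>

lemma topspace_k_pullback:
  "topspace (k_pullback X p Y q) = {(x, y). x \<in> topspace X \<and> y \<in> topspace Y \<and> p x = q y}"
  by (auto simp: k_pullback_def)

lemma continuous_map_into_k_pullback:
  assumes "is_k_space A" "continuous_map A X a" "continuous_map A Y b"
    and "\<And>d. d \<in> topspace A \<Longrightarrow> p (a d) = q (b d)"
  shows "continuous_map A (k_pullback X p Y q) (\<lambda>d. (a d, b d))"
  unfolding k_pullback_def using assms
  by (intro continuous_map_into_kify continuous_map_into_subtopology continuous_intros) auto

text \<open>The identity of \<open>C\<close> is itself a test map.\<close>

lemma is_k_space_compact_Hausdorff:
  assumes "compact_space C" "Hausdorff_space C"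
  shows "is_k_space C"
proof (rule is_k_spaceI)
  fix U assume U: "openin (kify C) U"
  have "continuous_map C C (\<lambda>c. c)" by simp
  from openin_kify_preimage[OF U assms this] show "openin C U"
    using U by (simp add: openin_kify Collect_conj_eq Int_absorb1)
qed

text \<open>The set is the preimage of the diagonal. The diagonal is closed only in
  \<open>k_prod B B\<close>, and the pair \<open>(u, v)\<close> is continuous into it because
  \<open>D\<close> is a k-space.\<close>

lemma closedin_weak_Hausdorff_equalizer:
  assumes B: "weak_Hausdorff B" and D: "is_k_space D"
    and u: "continuous_map D B u" and v: "continuous_map D B v"
  shows "closedin D {d \<in> topspace D. u d = v d}"
proof -
  have "continuous_map D (k_prod B B) (\<lambda>d. (u d, v d))"
    unfolding k_prod_def using D u v by (intro continuous_map_into_kify continuous_intros)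
  from closedin_continuous_map_preimage[OF this B[unfolded weak_Hausdorff_def]]
  have "closedin D {d \<in> topspace D. (u d, v d) \<in> {(b, b) |b. b \<in> topspace B}}" .
  also have "{d \<in> topspace D. (u d, v d) \<in> {(b, b) |b. b \<in> topspace B}} = {d \<in> topspace D. u d = v d}"
    using u by (auto simp: continuous_map_def)
  finally show ?thesis .
qed

text \<open>A closed set of \<open>tilde Z\<close> other than the whole space comes from
  \<open>Z\<close>, so its preimage lies in the pullback part of the test space, which is
  closed.\<close>

lemma continuous_map_extend_by_None:
  fixes X :: "'x topology" and Y :: "'y topology"
  assumes B: "weak_Hausdorff B" and p: "continuous_map X B p" and q: "continuous_map Y B q"
    and f: "continuous_map (k_pullback X p Y q) Z f"
  shows "continuous_map (k_prod X Y) (tilde Z) (\<lambda>(x, y). if q y = p x then Some (f (x, y)) else None)"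
  unfolding k_prod_def
proof (rule continuous_map_from_kifyI)
  fix D :: "('x \<times> 'y + nat) set set topology" and t
  assume D: "compact_space D" "Hausdorff_space D" and t: "continuous_map D (prod_topology X Y) t"
  define a b where "a = fst \<circ> t" and "b = snd \<circ> t"
  have a: "continuous_map D X a" and b: "continuous_map D Y b"
    using t by (auto simp: continuous_map_pairwise a_def b_def)
  define A where "A = {d \<in> topspace D. p (a d) = q (b d)}"
  have A: "closedin D A"
    unfolding A_def
    using closedin_weak_Hausdorff_equalizer[OF B is_k_space_compact_Hausdorff[OF D]
        continuous_map_compose[OF a p] continuous_map_compose[OF b q]] by simp
  let ?A = "subtopology D A"
  have topA: "topspace ?A = A" by (auto simp: A_def)
  \<comment> \<open>Closedness makes \<open>A\<close> compact Hausdorff, hence a k-space, so the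
    test restricted to \<open>A\<close> is continuous into the k-ified pullback and \<open>f\<close>
    can be applied.\<close>
  have "compact_space ?A" "Hausdorff_space ?A"
    using D A by (auto simp: compact_space_subtopology closedin_compact_space Hausdorff_space_subtopology)
  then have "continuous_map ?A (k_pullback X p Y q) (\<lambda>d. (a d, b d))"
    using a b by (intro continuous_map_into_k_pullback is_k_space_compact_Hausdorff
        continuous_map_from_subtopology) (auto simp: A_def)
  from continuous_map_compose[OF this f] have fA: "continuous_map ?A Z (\<lambda>d. f (a d, b d))"
    by (simp add: o_def)
  have "continuous_map D (tilde Z) (\<lambda>d. if q (b d) = p (a d) then Some (f (a d, b d)) else None)"
    (is "continuous_map _ _ ?F")
    unfolding continuous_map_closedin
  proof (intro conjI allI impI)
    show "?F \<in> topspace D \<rightarrow> topspace (tilde Z)"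
    proof
      fix d assume "d \<in> topspace D"
      moreover have "f (a d, b d) \<in> topspace Z" if "d \<in> A"
        using fA that topA by (auto simp: continuous_map_def)
      ultimately show "?F d \<in> topspace (tilde Z)" by (auto simp: topspace_tilde A_def)
    qed
    fix G assume "closedin (tilde Z) G"
    then consider "G = topspace (tilde Z)" | G' where "closedin Z G'" "G = Some ` G'"
      unfolding closedin_tilde by blast
    then show "closedin D {d \<in> topspace D. ?F d \<in> G}"
    proof cases
      case 1
      then have "{d \<in> topspace D. ?F d \<in> G} = topspace D"
        using \<open>?F \<in> topspace D \<rightarrow> topspace (tilde Z)\<close> by blast
      then show ?thesis by simp
    next
      case 2
      have "{d \<in> topspace D. ?F d \<in> G} = {d \<in> topspace ?A. f (a d, b d) \<in> G'}"
        unfolding topA using 2(2) by (auto simp: A_def)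
      then show ?thesis
        using closedin_trans_full[OF closedin_continuous_map_preimage[OF fA 2(1)] A] by simp
    qed
  qed
  then show "continuous_map D (tilde Z) (\<lambda>c. case t c of (x, y) \<Rightarrow> if q y = p x then Some (f (x, y)) else None)"
    by (simp add: a_def b_def case_prod_unfold cong: if_cong)
qed

section \<open>Maps into the free range mapping space\<close>

lemma topspace_fibre_space: "topspace (fibre_space Y q b) = {y \<in> topspace Y. q y = b}"
  by (auto simp: fibre_space_def)

lemma continuous_map_k_pullback_fst: "continuous_map (k_pullback X p Y q) X fst"
  and continuous_map_k_pullback_snd: "continuous_map (k_pullback X p Y q) Y snd"
  unfolding k_pullback_def
  using continuous_map_compose[OF continuous_map_kify_id
      continuous_map_from_subtopology[OF continuous_map_fst]]
    continuous_map_compose[OF continuous_map_kify_id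
      continuous_map_from_subtopology[OF continuous_map_snd]]
  by (simp_all add: o_def)

lemma is_k_space_k_pullback: "is_k_space (k_pullback X p Y q)"
  by (simp add: k_pullback_def is_k_space_kify)

text \<open>This makes \<open>i\<close> well defined. It is the extension lemma for a one-point
  space sent to \<open>b\<close>, whose pullback with \<open>q\<close> projects to the fibre over
  \<open>b\<close>.\<close>

lemma free_range_ext_in_cont_maps:
  assumes Y: "is_k_space Y" and B: "weak_Hausdorff B" and q: "continuous_map Y B q"
    and g: "g \<in> free_range_carrier Y q B Z"
  shows "free_range_ext Y q g \<in> cont_maps Y (tilde Z)"
proof -
  obtain b h where bh: "g = (b, h)" "b \<in> topspace B" "continuous_map (fibre_space Y q b) Z h"
    using g by (auto simp: free_range_carrier_def cont_maps_def)
  let ?P = "discrete_topology {()}" and ?b = "\<lambda>_ :: unit. b"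
  have P: "compact_space ?P" "Hausdorff_space ?P" by (auto simp: compact_space_discrete_topology)
  have "continuous_map (k_pullback ?P ?b Y q) (fibre_space Y q b) snd"
    unfolding fibre_space_def
    by (intro continuous_map_into_kify continuous_map_into_subtopology
        is_k_space_k_pullback continuous_map_k_pullback_snd) (auto simp: topspace_k_pullback)
  from continuous_map_compose[OF this bh(3)]
  have "continuous_map (k_prod ?P Y) (tilde Z)
      (\<lambda>(x, y). if q y = ?b x then Some ((h \<circ> snd) (x, y)) else None)"
    using bh(2) by (intro continuous_map_extend_by_None[OF B _ q]) (simp, assumption)
  \<comment> \<open>Currying and taking the value at the only point \<open>()\<close> isolates the
    single map on \<open>Y\<close>.\<close>
  from funcset_mem[OF continuous_map_funspace[OF
        continuous_map_curry[OF is_k_space_compact_Hausdorff[OF P] Y this]], of "()"]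
  show ?thesis
    by (simp add: topspace_mapping_space free_range_ext_def bh(1) cong: if_cong)
qed

text \<open>The universal property of the initial topology for \<open>i\<close> and the projection;
  the outer k-ification is absorbed because \<open>X\<close> is a k-space.\<close>

lemma continuous_map_into_free_range_space_iff:
  assumes X: "is_k_space X" and Y: "is_k_space Y" and B: "weak_Hausdorff B"
    and q: "continuous_map Y B q"
  shows "continuous_map X (free_range_space Y q B Z) g \<longleftrightarrow>
    g \<in> topspace X \<rightarrow> free_range_carrier Y q B Z \<and> continuous_map X B (\<lambda>x. fst (g x)) \<and>
    continuous_map X (mapping_space Y (tilde Z)) (\<lambda>x. free_range_ext Y q (g x))"
    (is "_ \<longleftrightarrow> g \<in> _ \<rightarrow> ?E \<and> ?fst \<and> ?ext")
proof -
  define SW where "SW W = {h \<in> ?E. free_range_ext Y q h \<in> W}" for W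
  define SV where "SV V = {h \<in> ?E. free_range_proj h \<in> V}" for V
  let ?S = "{SW W |W. openin (mapping_space Y (tilde Z)) W} \<union> {SV V |V. openin B V}"
  have E: "\<Union>?S = ?E"
    using topspace_free_range_space[of Y q B Z]
    unfolding free_range_space_def topspace_kify topology_generated_by_topspace SW_def SV_def .
  have "continuous_map X (free_range_space Y q B Z) g \<longleftrightarrow>
      continuous_map X (topology_generated_by ?S) g"
    unfolding free_range_space_def SW_def SV_def
    using continuous_map_into_kify[OF X] continuous_map_into_kify_imp by blast
  also have "\<dots> \<longleftrightarrow> g \<in> topspace X \<rightarrow> ?E \<and>
      (\<forall>V. openin B V \<longrightarrow> openin X (g -` SV V \<inter> topspace X)) \<and>
      (\<forall>W. openin (mapping_space Y (tilde Z)) W \<longrightarrow> openin X (g -` SW W \<inter> topspace X))"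
    unfolding continuous_on_generated_topo_iff E by blast
  also have "\<dots> \<longleftrightarrow> g \<in> topspace X \<rightarrow> ?E \<and> ?fst \<and> ?ext"
  proof (rule conj_cong[OF refl])
    assume g: "g \<in> topspace X \<rightarrow> ?E"
    have "g -` SV V \<inter> topspace X = {x \<in> topspace X. fst (g x) \<in> V}" for V
      using g by (auto simp: SV_def free_range_proj_def)
    moreover have "g -` SW W \<inter> topspace X = {x \<in> topspace X. free_range_ext Y q (g x) \<in> W}" for W
      using g by (auto simp: SW_def)
    moreover have "(\<lambda>x. fst (g x)) \<in> topspace X \<rightarrow> topspace B"
      using g by (auto simp: free_range_carrier_def Pi_iff mem_Times_iff dest!: bspec)
    moreover have "(\<lambda>x. free_range_ext Y q (g x)) \<in> topspace X \<rightarrow> topspace (mapping_space Y (tilde Z))"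
      using g by (intro funcsetI) (auto simp: topspace_mapping_space Pi_iff simp del: split_paired_All
        intro!: free_range_ext_in_cont_maps[OF Y B q])
    ultimately show "(\<forall>V. openin B V \<longrightarrow> openin X (g -` SV V \<inter> topspace X)) \<and>
      (\<forall>W. openin (mapping_space Y (tilde Z)) W \<longrightarrow> openin X (g -` SW W \<inter> topspace X)) \<longleftrightarrow>
      ?fst \<and> ?ext"
      by (simp add: continuous_map_def)
  qed
  finally show ?thesis .
qed

section \<open>The two inverse correspondences\<close>

text \<open>The candidate inverse of \<open>uncurry_fibrewise\<close>. The tag \<open>p x\<close>
  makes it fibrewise by construction, and both restrictions keep it extensional, so that the inverse
  laws are equations of functions.\<close>

definition curry_fibrewise ::
  "'x topology \<Rightarrow> ('x \<Rightarrow> 'b) \<Rightarrow> 'y topology \<Rightarrow> ('y \<Rightarrow> 'b) \<Rightarrow>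
   ('x \<times> 'y \<Rightarrow> 'z) \<Rightarrow> ('x \<Rightarrow> 'b \<times> ('y \<Rightarrow> 'z))" where
  "curry_fibrewise X p Y q f =
     (\<lambda>x\<in>topspace X. (p x, \<lambda>y\<in>topspace (fibre_space Y q (p x)). f (x, y)))"

text \<open>Evaluation of \<open>free_range_ext\<close> is continuous into \<open>tilde Z\<close>.
  On the pullback the tag of \<open>g x\<close> equals \<open>q y\<close>, so the value is never
  \<open>None\<close> and continuity descends to \<open>Z\<close>.\<close>

lemma uncurry_fibrewise_in_cont_maps:
  assumes X: "is_k_space X" and Y: "is_k_space Y" and B: "weak_Hausdorff B"
    and q: "continuous_map Y B q"
    and g: "g \<in> fibrewise_maps X p (free_range_space Y q B Z) free_range_proj"
  shows "uncurry_fibrewise X p Y q g \<in> cont_maps (k_pullback X p Y q) Z"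
proof -
  let ?A = "k_pullback X p Y q"
  have "continuous_map X (free_range_space Y q B Z) g"
    and gp: "\<And>x. x \<in> topspace X \<Longrightarrow> fst (g x) = p x"
    using g by (auto simp: fibrewise_maps_def cont_maps_def free_range_proj_def)
  then have "continuous_map X (mapping_space Y (tilde Z)) (\<lambda>x. free_range_ext Y q (g x))"
    by (simp add: continuous_map_into_free_range_space_iff[OF X Y B q])
  then have "continuous_map ?A (mapping_space Y (tilde Z)) (\<lambda>z. free_range_ext Y q (g (fst z)))"
    using continuous_map_compose[OF continuous_map_k_pullback_fst] by (force simp: o_def)
  then have "continuous_map ?A (tilde Z) (\<lambda>z. free_range_ext Y q (g (fst z)) (snd z))"
    by (rule continuous_map_uncurry[OF _ continuous_map_k_pullback_snd is_k_space_k_pullback])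
  then have "continuous_map ?A (tilde Z) (\<lambda>z. Some (uncurry_fibrewise X p Y q g z))"
    by (rule continuous_map_eq)
      (auto simp: topspace_k_pullback free_range_ext_def uncurry_fibrewise_def gp)
  then show ?thesis
    unfolding continuous_map_tilde_Some_iff cont_maps_def
    using restrict_extensional by (auto simp only: uncurry_fibrewise_def mem_Collect_eq)
qed

text \<open>The values are continuous on fibres because each fibre over \<open>p x\<close> maps to
  the pullback as a slice. Continuity in \<open>x\<close> holds because applying
  \<open>free_range_ext\<close> gives the curried extension of \<open>f\<close> by
  \<open>None\<close>.\<close>

lemma curry_fibrewise_in_fibrewise_maps:
  assumes X: "is_k_space X" and Y: "is_k_space Y" and B: "weak_Hausdorff B"
    and p: "continuous_map X B p" and q: "continuous_map Y B q"
    and f: "continuous_map (k_pullback X p Y q) Z f"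
  shows "curry_fibrewise X p Y q f \<in> fibrewise_maps X p (free_range_space Y q B Z) free_range_proj"
proof -
  let ?g = "curry_fibrewise X p Y q f"
  have "continuous_map X (free_range_space Y q B Z) ?g"
    unfolding continuous_map_into_free_range_space_iff[OF X Y B q]
  proof (intro conjI)
    show "?g \<in> topspace X \<rightarrow> free_range_carrier Y q B Z"
    proof
      fix x assume x: "x \<in> topspace X"
      let ?F = "fibre_space Y q (p x)"
      have "continuous_map ?F Y (\<lambda>y. y)"
        unfolding fibre_space_def
        by (intro continuous_map_into_fulltopology[OF continuous_map_kify_id])
      then have "continuous_map ?F (k_pullback X p Y q) (\<lambda>y. (x, y))"
        using x by (intro continuous_map_into_k_pullback)
          (auto simp: fibre_space_def is_k_space_kify)
      from continuous_map_compose[OF this f]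
      have "continuous_map ?F Z (\<lambda>y\<in>topspace ?F. f (x, y))"
        by (rule continuous_map_eq) auto
      then show "?g x \<in> free_range_carrier Y q B Z"
        using x p by (auto simp: curry_fibrewise_def free_range_carrier_def cont_maps_def continuous_map_def)
    qed
    show "continuous_map X B (\<lambda>x. fst (?g x))"
      using p by (rule continuous_map_eq) (simp add: curry_fibrewise_def)
    show "continuous_map X (mapping_space Y (tilde Z)) (\<lambda>x. free_range_ext Y q (?g x))"
      by (rule continuous_map_eq[OF continuous_map_curry[OF X Y continuous_map_extend_by_None[OF B p q f]]])
        (auto simp: free_range_ext_def curry_fibrewise_def topspace_fibre_space)
  qed
  then show ?thesis
    by (auto simp: fibrewise_maps_def cont_maps_def free_range_proj_def curry_fibrewise_def)
qed

text \<open>The fibrewise condition recovers the tag of \<open>g x\<close>; the other component is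
  extensional on the fibre over \<open>p x\<close>, which is exactly the slice of the pullback at
  \<open>x\<close>.\<close>

lemma curry_uncurry_fibrewise:
  assumes "g \<in> fibrewise_maps X p (free_range_space Y q B Z) free_range_proj"
  shows "curry_fibrewise X p Y q (uncurry_fibrewise X p Y q g) = g"
proof
  fix x
  have ext: "g \<in> extensional (topspace X)"
    using assms by (simp add: fibrewise_maps_def cont_maps_def)
  show "curry_fibrewise X p Y q (uncurry_fibrewise X p Y q g) x = g x"
  proof (cases "x \<in> topspace X")
    case False
    then show ?thesis using ext by (simp add: curry_fibrewise_def extensional_def)
  next
    case True
    have "g x \<in> free_range_carrier Y q B Z" "fst (g x) = p x"
      using assms True
      by (auto simp: fibrewise_maps_def cont_maps_def continuous_map_def topspace_free_range_space
          free_range_proj_def)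
    then obtain h where h: "g x = (p x, h)" "h \<in> extensional (topspace (fibre_space Y q (p x)))"
      by (cases "g x") (auto simp: free_range_carrier_def cont_maps_def)
    have "(\<lambda>y\<in>topspace (fibre_space Y q (p x)). uncurry_fibrewise X p Y q g (x, y)) = h"
      using True h by (intro extensionalityI[OF restrict_extensional h(2)])
        (simp add: uncurry_fibrewise_def topspace_k_pullback topspace_fibre_space)
    then show ?thesis using True h(1) by (simp add: curry_fibrewise_def)
  qed
qed

lemma uncurry_curry_fibrewise:
  assumes "f \<in> extensional (topspace (k_pullback X p Y q))"
  shows "uncurry_fibrewise X p Y q (curry_fibrewise X p Y q f) = f"
  using assms
  by (intro extensionalityI[of _ "topspace (k_pullback X p Y q)"])
    (auto simp: uncurry_fibrewise_def curry_fibrewise_def topspace_k_pullback topspace_fibre_space)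

theorem theorem6:
  fixes X :: "'x topology" and Y :: "'y topology" and Z :: "'z topology" and B :: "'b topology"
    and p :: "'x \<Rightarrow> 'b" and q :: "'y \<Rightarrow> 'b" and r :: "'z \<Rightarrow> 'b"
  assumes "is_k_space X" and "is_k_space Y" and "is_k_space Z" and "is_k_space B"
    and "weak_Hausdorff B"
    and "continuous_map X B p" and "continuous_map Y B q" and "continuous_map Z B r"
  shows "bij_betw (uncurry_fibrewise X p Y q)
    (fibrewise_maps X p (free_range_space Y q B Z) free_range_proj)
    (cont_maps (k_pullback X p Y q) Z)"
proof (rule bij_betw_byWitness[where f' = "curry_fibrewise X p Y q"])
  let ?M = "fibrewise_maps X p (free_range_space Y q B Z) free_range_proj"
    and ?N = "cont_maps (k_pullback X p Y q) Z"
  show "\<forall>g\<in>?M. curry_fibrewise X p Y q (uncurry_fibrewise X p Y q g) = g"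
    by (intro ballI curry_uncurry_fibrewise)
  show "\<forall>f\<in>?N. uncurry_fibrewise X p Y q (curry_fibrewise X p Y q f) = f"
    by (simp add: cont_maps_def uncurry_curry_fibrewise)
  show "uncurry_fibrewise X p Y q ` ?M \<subseteq> ?N"
    using assms by (intro image_subsetI uncurry_fibrewise_in_cont_maps)
  show "curry_fibrewise X p Y q ` ?N \<subseteq> ?M"
    using assms by (intro image_subsetI curry_fibrewise_in_fibrewise_maps) (simp_all add: cont_maps_def)
qed

end
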